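(* Let $\mathbb F$ and $\mathcal F$ be two subsets of $\mathfrak F$ with minimax rates $\phi_n(\mathbb F)$ and $\phi_n(\mathcal F)$ for estimating $\Phi$, and let $c\in(0,1)$ be such that $$\alpha_n(c):=\frac{\phi_n(\mathcal F)}{[\phi_n(\mathbb F)]^c}\to\infty,\qquad n\to\infty.$$ Let $f_0$, $M$, $\Lambda_1,\dots,\Lambda_M$, $\mathbb Y$, $\mathbb P$ (possibly depending on $n$) and the sequence $\psi_n$ be such that the following hold, with the notation of the context. (1) There are pairwise disjoint sets $\Pi_1,\dots,\Pi_M\in\mathfrak B(\mathcal X)$ with $\mathrm{supp}(\Lambda_m)=\Pi_m$ for all $m=1,\dots,M$. (2) $f_0\in\mathbb F$ and $f_0(x)>0$ for all $x\in\bigcup_{m=1}^M\Pi_m$. (3) $\mathbb P^M(\mathbb Y_{\mathcal F})\ge\frac{230}{231}$, where $\mathbb Y_{\mathcal F}=\{y\in\mathbb Y^M:\ f_y\in\mathcal F\}$. (4) $\psi_n\to0$ and $\psi_n\phi_n^{-1}(\mathcal F)\to+\infty$ as $n\to\infty$, and $\mathbb P^M(\mathbb Y_\Phi(\psi_n))\ge\frac{230}{231}$ for all $n$ large enough, where $\mathbb Y_\Phi(a)=\{y\in\mathbb Y^M:\ |\Phi(f_y)-\Phi(f_0)|>2a\}$ for $a>0$. (5) Either $\lambda_m=0$ for all $m=1,\dots,M$ and $\mathbb Y_+=\mathbb Y^M$; or $\mathbb Y^M\subseteq[0,1]^M$, $\Lambda_m:\mathcal X\to\mathbb R_+$ for all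 $m$, and $\Sigma_M\le0.25$, $256\,\mathfrak S_M^2Mn\le1$ for all $n$ large enough. Suppose additionally that for $\mathbf i=1$ and $\mathbf i=2$ $$\lim_{n\to\infty}\alpha_n^{-2}(c)\prod_{m=1}^M\int_{\mathbb R^2}e^{\mathbf i\,nS_muv}\,\mathbb P(\mathrm du)\,\mathbb P(\mathrm dv)=0.$$ Then $$\liminf_{n\to\infty}\inf_{\widetilde\Phi}\Big\{\phi_n^{-2c}(\mathbb F)\,\mathcal R_n^2\big[\widetilde\Phi,\mathbb F\big]+\psi_n^{-2}\,\mathcal R_n^2\big[\widetilde\Phi,\mathcal F\big]\Big\}\ge\frac{107}{144e},$$ where the infimum is over all estimators.
   Context: Abstract density model. $(\mathcal X,\mathfrak B(\mathcal X),\nu)$ is a measure space; one observes $X_1,\dots,X_n$ i.i.d. $\mathcal X$-valued with density $f$ with respect to $\nu$; $\mathbb E_f$ denotes expectation under the law of $(X_1,\dots,X_n)$. $\Phi$ is a given real functional and $\mathfrak F$ is the set of all probability densities $f$ (w.r.t. $\nu$) with $|\Phi(f)|<\infty$. An estimator $\widetilde\Phi$ is any measurable real function of $(X_1,\dots,X_n)$. For a subset $\mathbb F\subset\mathfrak F$, $\mathcal R_n[\widetilde\Phi,\mathbb F]=\sup_{f\in\mathbb F}\big(\mathbb E_f[\widetilde\Phi-\Phi(f)]^2\big)^{1/2}$; the minimax risk is $\inf_{\widetilde\Phi}\mathcal R_n[\widetilde\Phi,\mathbb F]$ and the minimax rate $\phi_n(\mathbb F)$ is the order at which it tends to zero. Parameterized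 family (all objects may depend on $n$). $f_0\in\mathfrak F$ is a density, $M\ge1$ an integer, $\Lambda_m:\mathcal X\to\mathbb R$, $m=1,\dots,M$, measurable square-integrable functions, $\mathbb Y\subseteq\mathbb R$ an interval, $\mathbb P$ a probability measure on $\mathbb Y$, and $\mathbb P^M=\mathbb P\times\cdots\times\mathbb P$ the product measure on $\mathbb Y^M$. Put $\lambda_m=\int_{\mathcal X}\Lambda_m\,\mathrm d\nu$, $\rho_y=\sum_{m=1}^My_m\lambda_m$ and, for $y=(y_1,\dots,y_M)\in\mathbb Y^M$, $$f_y(x)=(1-\rho_y)f_0(x)+\sum_{m=1}^My_m\Lambda_m(x),\quad x\in\mathcal X.$$ Further, $e_1=\int_{\mathbb R}u\,\mathbb P(\mathrm du)$, $\Sigma_M=e_1\sum_{m=1}^M\lambda_m$, $\mathfrak S_M=\sup_{m=1,\dots,M}|\lambda_m|$, $\mathbb Y_+=\{y\in\mathbb Y^M:\ \inf_{x\in\mathcal X}f_y(x)\ge0\}$, and $S_m=\int_{\mathcal X}\frac{\Lambda_m^2(x)}{f_0(x)}\nu(\mathrm dx)$ (well defined by hypothesis (2)). All quantities involving $\mathbb P$ are tacitly assumed to exist. *)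

theory Defs
  imports "HOL-Probability.Probability"
begin

section \<open>The density model\<close>

definition prob_density :: "'a measure \<Rightarrow> ('a \<Rightarrow> real) \<Rightarrow> bool" where
  "prob_density \<nu> f \<longleftrightarrow>
     f \<in> borel_measurable \<nu> \<and> (\<forall>x\<in>space \<nu>. 0 \<le> f x) \<and> (\<integral>\<^sup>+x. ennreal (f x) \<partial>\<nu>) = 1"

text \<open>The functional takes extended real values, so that finiteness on the class of admissible
  densities is a genuine condition.\<close>

definition admissible_densities ::
  "'a measure \<Rightarrow> (('a \<Rightarrow> real) \<Rightarrow> ereal) \<Rightarrow> ('a \<Rightarrow> real) set" where
  "admissible_densities \<nu> \<Phi> = {f. prob_density \<nu> f \<and> \<bar>\<Phi> f\<bar> < \<infinity>}"

text \<open>Joint law of \<open>n\<close> independent observations with density \<open>f\<close>; the observations are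
  indexed by \<open>{1..n}\<close>.\<close>

definition sample_law :: "'a measure \<Rightarrow> nat \<Rightarrow> ('a \<Rightarrow> real) \<Rightarrow> (nat \<Rightarrow> 'a) measure" where
  "sample_law \<nu> n f = (\<Pi>\<^sub>M i\<in>{1..n}. density \<nu> (\<lambda>x. ennreal (f x)))"

text \<open>Only the \<open>\<sigma>\<close>-algebra of the product space below matters; \<open>\<nu>\<close> need not be \<open>\<sigma>\<close>-finite.\<close>

definition estimators :: "'a measure \<Rightarrow> nat \<Rightarrow> ((nat \<Rightarrow> 'a) \<Rightarrow> real) set" where
  "estimators \<nu> n = borel_measurable (\<Pi>\<^sub>M i\<in>{1..n}. \<nu>)"

definition ennreal_sqrt :: "ennreal \<Rightarrow> ennreal" where
  "ennreal_sqrt x = (if x = \<infinity> then \<infinity> else ennreal (sqrt (enn2real x)))"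

text \<open>The risk may be infinite, hence the values in the extended nonnegative reals.\<close>

definition risk ::
  "'a measure \<Rightarrow> (('a \<Rightarrow> real) \<Rightarrow> ereal) \<Rightarrow> nat \<Rightarrow> ((nat \<Rightarrow> 'a) \<Rightarrow> real) \<Rightarrow> ('a \<Rightarrow> real) set \<Rightarrow> ennreal"
  where
  "risk \<nu> \<Phi> n T F =
     (SUP f\<in>F. ennreal_sqrt
        (\<integral>\<^sup>+x. ennreal ((T x - real_of_ereal (\<Phi> f))\<^sup>2) \<partial>sample_law \<nu> n f))"

definition minimax_risk ::
  "'a measure \<Rightarrow> (('a \<Rightarrow> real) \<Rightarrow> ereal) \<Rightarrow> nat \<Rightarrow> ('a \<Rightarrow> real) set \<Rightarrow> ennreal" where
  "minimax_risk \<nu> \<Phi> n F = (INF T\<in>estimators \<nu> n. risk \<nu> \<Phi> n T F)"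

text \<open>A minimax rate is determined up to order: it is any positive null sequence that the minimax
  risk matches up to constant factors.\<close>

definition minimax_rate ::
  "'a measure \<Rightarrow> (('a \<Rightarrow> real) \<Rightarrow> ereal) \<Rightarrow> ('a \<Rightarrow> real) set \<Rightarrow> (nat \<Rightarrow> real) \<Rightarrow> bool" where
  "minimax_rate \<nu> \<Phi> F \<phi> \<longleftrightarrow>
     (\<forall>\<^sub>F n in sequentially. 0 < \<phi> n) \<and> \<phi> \<longlonglongrightarrow> 0 \<and>
     (\<exists>a>0. \<exists>b>0. \<forall>\<^sub>F n in sequentially.
        ennreal (a * \<phi> n) \<le> minimax_risk \<nu> \<Phi> n F \<and> minimax_risk \<nu> \<Phi> n F \<le> ennreal (b * \<phi> n))"


section \<open>The parameterized family\<close>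

text \<open>There is no topology on the sample space: the support is the set where the function does
  not vanish.\<close>

definition supp_on :: "'a measure \<Rightarrow> ('a \<Rightarrow> real) \<Rightarrow> 'a set" where
  "supp_on \<nu> g = {x\<in>space \<nu>. g x \<noteq> 0}"

definition lam :: "'a measure \<Rightarrow> (nat \<Rightarrow> 'a \<Rightarrow> real) \<Rightarrow> nat \<Rightarrow> real" where
  "lam \<nu> \<Lambda> m = (\<integral>x. \<Lambda> m x \<partial>\<nu>)"

definition rho :: "'a measure \<Rightarrow> (nat \<Rightarrow> 'a \<Rightarrow> real) \<Rightarrow> nat \<Rightarrow> (nat \<Rightarrow> real) \<Rightarrow> real" where
  "rho \<nu> \<Lambda> M y = (\<Sum>m=1..M. y m * lam \<nu> \<Lambda> m)"

definition f_par ::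
  "'a measure \<Rightarrow> ('a \<Rightarrow> real) \<Rightarrow> (nat \<Rightarrow> 'a \<Rightarrow> real) \<Rightarrow> nat \<Rightarrow> (nat \<Rightarrow> real) \<Rightarrow> 'a \<Rightarrow> real" where
  "f_par \<nu> f0 \<Lambda> M y x = (1 - rho \<nu> \<Lambda> M y) * f0 x + (\<Sum>m=1..M. y m * \<Lambda> m x)"

definition prob_on :: "real set \<Rightarrow> real measure \<Rightarrow> bool" where
  "prob_on Y P \<longleftrightarrow> prob_space P \<and> sets P = sets (restrict_space borel Y)"

definition cube :: "real set \<Rightarrow> nat \<Rightarrow> (nat \<Rightarrow> real) set" where
  "cube Y M = {1..M} \<rightarrow>\<^sub>E Y"

definition prod_prob :: "real measure \<Rightarrow> nat \<Rightarrow> (nat \<Rightarrow> real) measure" where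
  "prod_prob P M = (\<Pi>\<^sub>M m\<in>{1..M}. P)"

definition e1 :: "real measure \<Rightarrow> real" where
  "e1 P = (\<integral>u. u \<partial>P)"

definition Sigma_tot :: "'a measure \<Rightarrow> (nat \<Rightarrow> 'a \<Rightarrow> real) \<Rightarrow> nat \<Rightarrow> real measure \<Rightarrow> real" where
  "Sigma_tot \<nu> \<Lambda> M P = e1 P * (\<Sum>m=1..M. lam \<nu> \<Lambda> m)"

definition S_sup :: "'a measure \<Rightarrow> (nat \<Rightarrow> 'a \<Rightarrow> real) \<Rightarrow> nat \<Rightarrow> real" where
  "S_sup \<nu> \<Lambda> M = (SUP m\<in>{1..M}. \<bar>lam \<nu> \<Lambda> m\<bar>)"

definition Y_plus ::
  "'a measure \<Rightarrow> ('a \<Rightarrow> real) \<Rightarrow> (nat \<Rightarrow> 'a \<Rightarrow> real) \<Rightarrow> nat \<Rightarrow> real set \<Rightarrow> (nat \<Rightarrow> real) set" where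
  "Y_plus \<nu> f0 \<Lambda> M Y = {y\<in>cube Y M. 0 \<le> (INF x\<in>space \<nu>. ereal (f_par \<nu> f0 \<Lambda> M y x))}"

text \<open>If one of the following two sets is not measurable, then its measure is \<open>0\<close>. A lower
  bound on the measure therefore includes measurability.\<close>

definition Y_class ::
  "'a measure \<Rightarrow> ('a \<Rightarrow> real) \<Rightarrow> (nat \<Rightarrow> 'a \<Rightarrow> real) \<Rightarrow> nat \<Rightarrow> real set \<Rightarrow> ('a \<Rightarrow> real) set
     \<Rightarrow> (nat \<Rightarrow> real) set" where
  "Y_class \<nu> f0 \<Lambda> M Y G = {y\<in>cube Y M. f_par \<nu> f0 \<Lambda> M y \<in> G}"

definition Y_func ::
  "'a measure \<Rightarrow> (('a \<Rightarrow> real) \<Rightarrow> ereal) \<Rightarrow> ('a \<Rightarrow> real) \<Rightarrow> (nat \<Rightarrow> 'a \<Rightarrow> real) \<Rightarrow> nat \<Rightarrow> real set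
     \<Rightarrow> real \<Rightarrow> (nat \<Rightarrow> real) set" where
  "Y_func \<nu> \<Phi> f0 \<Lambda> M Y a =
     {y\<in>cube Y M. \<bar>\<Phi> (f_par \<nu> f0 \<Lambda> M y) - \<Phi> f0\<bar> > ereal (2 * a)}"

text \<open>The integrand vanishes off the support of \<open>\<Lambda> m\<close> (also where \<open>f0 x = 0\<close>, as \<open>0 / 0 = 0\<close>).
  The value may be infinite, so no finiteness is presupposed.\<close>

definition S_int :: "'a measure \<Rightarrow> ('a \<Rightarrow> real) \<Rightarrow> (nat \<Rightarrow> 'a \<Rightarrow> real) \<Rightarrow> nat \<Rightarrow> ennreal" where
  "S_int \<nu> f0 \<Lambda> m = (\<integral>\<^sup>+x. ennreal ((\<Lambda> m x)\<^sup>2 / f0 x) \<partial>\<nu>)"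

definition exp_ereal :: "ereal \<Rightarrow> ennreal" where
  "exp_ereal x =
     (if x = \<infinity> then \<infinity> else if x = -\<infinity> then 0 else ennreal (exp (real_of_ereal x)))"

definition exp_moment :: "real measure \<Rightarrow> nat \<Rightarrow> nat \<Rightarrow> ennreal \<Rightarrow> ennreal" where
  "exp_moment P i n S =
     (\<integral>\<^sup>+v. (\<integral>\<^sup>+u. exp_ereal (ereal (real i * real n) * enn2ereal S * ereal (u * v)) \<partial>P) \<partial>P)"

definition alpha_ratio :: "(nat \<Rightarrow> real) \<Rightarrow> (nat \<Rightarrow> real) \<Rightarrow> real \<Rightarrow> nat \<Rightarrow> real" where
  "alpha_ratio \<phi>G \<phi>F c n = \<phi>G n / (\<phi>F n powr c)"

end

theory Submission
  imports Defs
begin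

text \<open>Let \<open>B\<close> be the set of \<open>y\<close> with \<open>f\<^sub>y \<in> G\<close> and \<open>\<Phi> f\<^sub>y\<close> separated from \<open>\<Phi> f\<^sub>0\<close>, let \<open>Z\<close> be the
  integral over \<open>B\<close> of the likelihood ratios of \<open>f\<^sub>y\<close> to \<open>f\<^sub>0\<close>, and let \<open>D\<close> be the event that the
  estimator misses \<open>\<Phi> f\<^sub>0\<close> by at least \<open>\<psi>\<close>. With \<open>t\<close> the square of the ratio \<open>\<alpha>\<close>, the two normalized
  squared risks dominate \<open>t P\<^sub>0(D)\<close> and \<open>E\<^sub>0[Z; -D]\<close>, whose sum is at least \<open>E\<^sub>0 Z - E\<^sub>0 Z\<^sup>2 / t\<close>. Here
  \<open>E\<^sub>0 Z\<close> is the mass of \<open>B\<close>, at least 229/231. Since the \<open>\<Lambda>\<^sub>m\<close> have disjoint supports,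
  one observation contributes \<open>1 - \<rho>\<^sub>y \<rho>\<^sub>z + \<Sum> y\<^sub>m z\<^sub>m S\<^sub>m\<close> to the cross moment of the likelihood ratios
  at \<open>y\<close> and \<open>z\<close>. In both alternatives \<open>\<rho>\<^sub>y \<rho>\<^sub>z \<ge> 0\<close>, so this is at most \<open>exp (\<Sum> y\<^sub>m z\<^sub>m S\<^sub>m)\<close>, and
  \<open>E\<^sub>0 Z\<^sup>2\<close> is at most the product of the exponential moments, which is of smaller order than \<open>t\<close>.
  An infinite \<open>S\<^sub>m\<close> would make this product infinite, unless \<open>P\<close> is the point mass at \<open>0\<close>, which
  the separation rules out.\<close>

section \<open>Product densities and joint measurability\<close>

text \<open>Boxes determine the product because each \<open>density N g\<close> is a probability
  measure. On a box the integral of the product of the densities factors, by independence under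
  \<open>N\<close>.\<close>

lemma PiM_density:
  fixes N :: "'a measure" and I :: "'i set"
  assumes "finite I" "prob_space N" and g: "g \<in> borel_measurable N" and "prob_space (density N g)"
  shows "(\<Pi>\<^sub>M i\<in>I. density N g) = density (\<Pi>\<^sub>M i\<in>I. N) (\<lambda>x. \<Prod>i\<in>I. g (x i))"
proof -
  interpret N: product_prob_space "\<lambda>_::'i. N"
    using assms(2) by (rule product_prob_spaceI)
  interpret Ng: product_prob_space "\<lambda>_::'i. density N g"
    using assms(4) by (rule product_prob_spaceI)
  have gm: "(\<lambda>x. \<Prod>i\<in>I. g (x i)) \<in> borel_measurable (\<Pi>\<^sub>M i\<in>I. N)"
    using g by measurable
  show ?thesis
  proof (rule sym, rule Ng.PiM_eqI)
    show "sets (density (\<Pi>\<^sub>M i\<in>I. N) (\<lambda>x. \<Prod>i\<in>I. g (x i))) = sets (\<Pi>\<^sub>M i\<in>I. density N g)"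
      by (simp cong: sets_PiM_cong)
    fix A assume A: "\<And>i. i \<in> I \<Longrightarrow> A i \<in> sets (density N g)"
    have "emeasure (density (\<Pi>\<^sub>M i\<in>I. N) (\<lambda>x. \<Prod>i\<in>I. g (x i))) (Pi\<^sub>E I A) =
       (\<integral>\<^sup>+x. (\<Prod>i\<in>I. g (x i)) * indicator (Pi\<^sub>E I A) x \<partial>(\<Pi>\<^sub>M i\<in>I. N))"
      using A gm by (intro emeasure_density) (auto intro!: sets_PiM_I_finite assms(1))
    also have "\<dots> = (\<integral>\<^sup>+x. (\<Prod>i\<in>I. g (x i) * indicator (A i) (x i)) \<partial>(\<Pi>\<^sub>M i\<in>I. N))"
    proof (rule nn_integral_cong)
      fix x assume "x \<in> space (\<Pi>\<^sub>M i\<in>I. N)"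
      then have "indicator (Pi\<^sub>E I A) x = (\<Prod>i\<in>I. indicator (A i) (x i) :: ennreal)"
        using assms(1) by (auto simp: indicator_def space_PiM PiE_def Pi_def)
      then show "(\<Prod>i\<in>I. g (x i)) * indicator (Pi\<^sub>E I A) x = (\<Prod>i\<in>I. g (x i) * indicator (A i) (x i))"
        by (simp add: prod.distrib)
    qed
    also have "\<dots> = (\<Prod>i\<in>I. \<integral>\<^sup>+x. g x * indicator (A i) x \<partial>N)"
      using A g by (intro N.product_nn_integral_prod assms(1)) auto
    also have "\<dots> = (\<Prod>i\<in>I. emeasure (density N g) (A i))"
      using A g by (intro prod.cong) (auto simp: emeasure_density)
    finally show "emeasure (density (\<Pi>\<^sub>M i\<in>I. N) (\<lambda>x. \<Prod>i\<in>I. g (x i))) (Pi\<^sub>E I A) =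
       (\<Prod>i\<in>I. emeasure (density N g) (A i))" .
  qed (use assms in auto)
qed

text \<open>Carries joint measurability over to a curried function composed with arbitrary
  measurable maps, a shape that the measurability prover can chain.\<close>

lemma measurable_curried:
  assumes "case_prod q \<in> measurable (R \<Otimes>\<^sub>M N) K" "f \<in> measurable L R" "g \<in> measurable L N"
  shows "(\<lambda>x. q (f x) (g x)) \<in> measurable L K"
  using measurable_compose[OF measurable_Pair[OF assms(2,3)] assms(1)] by simp

section \<open>Truncated second moment of a mixture\<close>

text \<open>Either \<open>z\<close> is at most \<open>t\<close>, or \<open>t * z\<close> is at most
  \<open>z * z\<close> and the quadratic term alone dominates. The bound acts as a truncation of
  \<open>z\<close> at level \<open>t\<close>.\<close>

lemma ennreal_le_add_square_div:
  fixes z :: ennreal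
  assumes "0 < t"
  shows "z \<le> ennreal t + ennreal (1 / t) * z\<^sup>2"
proof (cases z)
  case (real r)
  have "r \<le> t + 1 / t * r\<^sup>2"
  proof (cases "r \<le> t")
    case True
    then show ?thesis using assms by (simp add: add_increasing2)
  next
    case False
    then have "t * r \<le> r * r" using assms by (intro mult_right_mono) auto
    then have "r \<le> 1 / t * r\<^sup>2" using assms by (simp add: field_simps power2_eq_square)
    then show ?thesis using assms by simp
  qed
  then show ?thesis using real assms
    by (simp add: ennreal_power flip: ennreal_mult ennreal_plus)
next
  case top
  then show ?thesis using assms by (simp add: ennreal_mult_top power2_eq_square)
qed

text \<open>Splits the mass of a mixture \<open>Z = \<integral>\<^sub>B q y \<partial>R\<close> of densities by means of
  \<open>Z \<le> t 1\<^sub>D + Z 1\<^bsub>-D\<^esub> + Z\<^sup>2 / t\<close>.\<close>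

lemma mixture_second_moment_bound:
  fixes q :: "'b \<Rightarrow> 'c \<Rightarrow> ennreal"
  assumes "prob_space R" "prob_space N"
    and q: "case_prod q \<in> borel_measurable (R \<Otimes>\<^sub>M N)"
    and B: "B \<in> sets R" and D: "D \<in> sets N" and t: "0 < t"
  shows "(\<integral>\<^sup>+y\<in>B. (\<integral>\<^sup>+x. q y x \<partial>N) \<partial>R) \<le>
     ennreal t * emeasure N D + (\<integral>\<^sup>+y\<in>B. (\<integral>\<^sup>+x\<in>space N - D. q y x \<partial>N) \<partial>R) +
     ennreal (1 / t) * (\<integral>\<^sup>+y\<in>B. (\<integral>\<^sup>+z\<in>B. (\<integral>\<^sup>+x. q y x * q z x \<partial>N) \<partial>R) \<partial>R)"
proof -
  interpret R: prob_space R by fact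
  interpret N: prob_space N by fact
  interpret RN: pair_sigma_finite R N ..
  note [measurable] = B D
  note [measurable] = measurable_curried[OF q]
  define Z where "Z x = (\<integral>\<^sup>+y\<in>B. q y x \<partial>R)" for x
  have [measurable]: "Z \<in> borel_measurable N" unfolding Z_def by measurable
  \<comment> \<open>Tonelli for the mixture against a test weight \<open>h\<close>. It is used with
    \<open>h = 1\<close> for the total mass, with \<open>h = q y\<close> and \<open>h = Z\<close>
    for the second moment, and with the indicator of the complement of \<open>D\<close>.\<close>
  have swap: "(\<integral>\<^sup>+y\<in>B. (\<integral>\<^sup>+x. q y x * h x \<partial>N) \<partial>R) = (\<integral>\<^sup>+x. Z x * h x \<partial>N)"
    if [measurable]: "h \<in> borel_measurable N" for h
  proof -
    have "(\<integral>\<^sup>+y\<in>B. (\<integral>\<^sup>+x. q y x * h x \<partial>N) \<partial>R) =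
       (\<integral>\<^sup>+y. (\<integral>\<^sup>+x. q y x * h x * indicator B y \<partial>N) \<partial>R)"
    proof (rule nn_integral_cong)
      fix y assume [measurable]: "y \<in> space R"
      show "(\<integral>\<^sup>+x. q y x * h x \<partial>N) * indicator B y = (\<integral>\<^sup>+x. q y x * h x * indicator B y \<partial>N)"
        by (subst nn_integral_multc) auto
    qed
    also have "\<dots> = (\<integral>\<^sup>+x. (\<integral>\<^sup>+y. q y x * h x * indicator B y \<partial>R) \<partial>N)"
      by (rule RN.Fubini'[symmetric]) measurable
    also have "\<dots> = (\<integral>\<^sup>+x. Z x * h x \<partial>N)"
    proof (rule nn_integral_cong)
      fix x assume [measurable]: "x \<in> space N"
      show "(\<integral>\<^sup>+y. q y x * h x * indicator B y \<partial>R) = Z x * h x"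
        unfolding Z_def by (subst nn_integral_multc[symmetric]) (auto simp: ac_simps)
    qed
    finally show ?thesis .
  qed
  have sq: "(\<integral>\<^sup>+y\<in>B. (\<integral>\<^sup>+z\<in>B. (\<integral>\<^sup>+x. q y x * q z x \<partial>N) \<partial>R) \<partial>R) = (\<integral>\<^sup>+x. (Z x)\<^sup>2 \<partial>N)"
  proof -
    have "(\<integral>\<^sup>+z\<in>B. (\<integral>\<^sup>+x. q y x * q z x \<partial>N) \<partial>R) = (\<integral>\<^sup>+x. q y x * Z x \<partial>N)"
      if [measurable]: "y \<in> space R" for y
      using swap[of "q y"] that by (simp add: mult.commute)
    then have "(\<integral>\<^sup>+y\<in>B. (\<integral>\<^sup>+z\<in>B. (\<integral>\<^sup>+x. q y x * q z x \<partial>N) \<partial>R) \<partial>R) =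
      (\<integral>\<^sup>+y\<in>B. (\<integral>\<^sup>+x. q y x * Z x \<partial>N) \<partial>R)"
      by (intro nn_integral_cong) simp
    also have "\<dots> = (\<integral>\<^sup>+x. (Z x)\<^sup>2 \<partial>N)"
      using swap[of Z] by (simp add: power2_eq_square)
    finally show ?thesis .
  qed
  have "(\<integral>\<^sup>+y\<in>B. (\<integral>\<^sup>+x. q y x \<partial>N) \<partial>R) = (\<integral>\<^sup>+x. Z x \<partial>N)"
    using swap[of "\<lambda>_. 1"] by simp
  \<comment> \<open>The truncation is spent only on \<open>D\<close>; off \<open>D\<close> the
    summand \<open>Z\<close> already suffices.\<close>
  also have "\<dots> \<le> (\<integral>\<^sup>+x. (ennreal t * indicator D x + Z x * indicator (space N - D) x) +
      ennreal (1 / t) * (Z x)\<^sup>2 \<partial>N)"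
    using ennreal_le_add_square_div[OF t] by (intro nn_integral_mono) (auto split: split_indicator)
  also have "\<dots> = ennreal t * emeasure N D + (\<integral>\<^sup>+x. Z x * indicator (space N - D) x \<partial>N) +
      ennreal (1 / t) * (\<integral>\<^sup>+x. (Z x)\<^sup>2 \<partial>N)"
    by (simp add: nn_integral_add nn_integral_cmult)
  finally show ?thesis
    by (subst sq) (subst swap, simp_all)
qed

section \<open>Lower bounds for exponential moments\<close>

text \<open>A law other than the point mass at 0 charges one of the two open half-lines. On the
  square of that half-line \<open>u * v\<close> is positive, so the integrand is at least 1, and it
  is infinite when \<open>S\<close> is infinite and \<open>i\<close>, \<open>n\<close> are
  positive.\<close>

lemma exp_moment_bounds:
  assumes P: "prob_space P" and U: "(\<lambda>u. u) \<in> borel_measurable P" and ne: "\<not> (AE u in P. u = 0)"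
  shows "exp_moment P i n S \<noteq> 0"
    and "0 < i \<Longrightarrow> 0 < n \<Longrightarrow> exp_moment P i n \<infinity> = \<infinity>"
proof -
  interpret prob_space P by fact
  note [measurable] = U
  obtain A where A[measurable]: "A \<in> sets P" and A0: "emeasure P A \<noteq> 0"
    and pos: "\<And>u v. u \<in> A \<Longrightarrow> v \<in> A \<Longrightarrow> 0 < u * v"
  proof (cases "emeasure P {u\<in>space P. 0 < u} = 0")
    case True
    have "emeasure P {u\<in>space P. u < 0} \<noteq> 0"
    proof
      assume *: "emeasure P {u\<in>space P. u < 0} = 0"
      have "AE u in P. \<not> 0 < u" "AE u in P. \<not> u < 0"
        using True * by (subst AE_iff_measurable[OF _ refl]; simp)+
      then have "AE u in P. u = 0" by eventually_elim auto
      with ne show False by simp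
    qed
    then show ?thesis by (intro that[of "{u\<in>space P. u < 0}"]) (auto simp: mult_neg_neg)
  next
    case False
    then show ?thesis by (intro that[of "{u\<in>space P. 0 < u}"]) auto
  qed
  have lower: "k * (emeasure P A * emeasure P A) \<le> exp_moment P i n S"
    if "\<And>u v. u \<in> A \<Longrightarrow> v \<in> A \<Longrightarrow> k \<le> exp_ereal (ereal (real i * real n) * enn2ereal S * ereal (u * v))"
    for k S
  proof -
    have "k * (emeasure P A * emeasure P A) =
        (\<integral>\<^sup>+v. (\<integral>\<^sup>+u. k * indicator A u * indicator A v \<partial>P) \<partial>P)"
      by (simp add: nn_integral_multc nn_integral_cmult mult.assoc)
    also have "\<dots> \<le> exp_moment P i n S"
      unfolding exp_moment_def using that
      by (intro nn_integral_mono) (auto split: split_indicator)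
    finally show ?thesis .
  qed
  have "1 * (emeasure P A * emeasure P A) \<le> exp_moment P i n S"
  proof (rule lower)
    fix u v assume "u \<in> A" "v \<in> A"
    then have "0 \<le> ereal (real i * real n) * enn2ereal S * ereal (u * v)"
      using pos[of u v] by (intro ereal_0_le_mult) auto
    then show "1 \<le> exp_ereal (ereal (real i * real n) * enn2ereal S * ereal (u * v))"
      by (cases "ereal (real i * real n) * enn2ereal S * ereal (u * v)")
         (auto simp: exp_ereal_def ennreal_ge_1)
  qed
  with A0 show "exp_moment P i n S \<noteq> 0" by auto
  assume "0 < i" "0 < n"
  then have "\<infinity> * (emeasure P A * emeasure P A) \<le> exp_moment P i n \<infinity>"
    by (intro lower) (use pos in \<open>force simp: exp_ereal_def\<close>)
  with A0 show "exp_moment P i n \<infinity> = \<infinity>"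
    by (auto simp: ennreal_top_mult top_unique)
qed

section \<open>Cross moments of likelihood ratios\<close>

text \<open>Termwise integration of the expanded integrand gives its exact value, and
  \<open>1 + x \<le> exp x\<close> finishes. The coefficients carry signs, so the terms are
  integrated in the Bochner sense; for the quadratic terms this rests on the finiteness of
  \<open>S_int\<close>.\<close>

lemma likelihood_cross_moment_le:
  assumes f0: "prob_density \<nu> f0"
    and \<Lambda>: "\<And>m. m \<in> {1..M} \<Longrightarrow> integrable \<nu> (\<Lambda> m)"
    and vanish: "\<And>m x. m \<in> {1..M} \<Longrightarrow> x \<in> space \<nu> \<Longrightarrow> f0 x = 0 \<Longrightarrow> \<Lambda> m x = 0"
    and orth: "\<And>m k x. m \<in> {1..M} \<Longrightarrow> k \<in> {1..M} \<Longrightarrow> m \<noteq> k \<Longrightarrow> x \<in> space \<nu> \<Longrightarrow> \<Lambda> m x * \<Lambda> k x = 0"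
    and S: "\<And>m. m \<in> {1..M} \<Longrightarrow> S_int \<nu> f0 \<Lambda> m < \<infinity>"
    and fy: "prob_density \<nu> (f_par \<nu> f0 \<Lambda> M y)" and fz: "prob_density \<nu> (f_par \<nu> f0 \<Lambda> M z)"
    and rho: "0 \<le> rho \<nu> \<Lambda> M y * rho \<nu> \<Lambda> M z"
  shows "(\<integral>\<^sup>+x. ennreal (f_par \<nu> f0 \<Lambda> M y x / f0 x) * ennreal (f_par \<nu> f0 \<Lambda> M z x / f0 x)
      \<partial>density \<nu> (\<lambda>x. ennreal (f0 x)))
    \<le> ennreal (exp (\<Sum>m=1..M. y m * z m * enn2real (S_int \<nu> f0 \<Lambda> m)))"
proof -
  define s where "s m = enn2real (S_int \<nu> f0 \<Lambda> m)" for m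
  let ?ry = "rho \<nu> \<Lambda> M y" and ?rz = "rho \<nu> \<Lambda> M z"
  have f0m[measurable]: "f0 \<in> borel_measurable \<nu>" and f0n: "\<And>x. x \<in> space \<nu> \<Longrightarrow> 0 \<le> f0 x"
    and f0i: "(\<integral>\<^sup>+x. ennreal (f0 x) \<partial>\<nu>) = 1"
    using f0 by (auto simp: prob_density_def)
  have [measurable]: "f_par \<nu> f0 \<Lambda> M y \<in> borel_measurable \<nu>" "f_par \<nu> f0 \<Lambda> M z \<in> borel_measurable \<nu>"
    and nonneg: "\<And>x. x \<in> space \<nu> \<Longrightarrow> 0 \<le> f_par \<nu> f0 \<Lambda> M y x" "\<And>x. x \<in> space \<nu> \<Longrightarrow> 0 \<le> f_par \<nu> f0 \<Lambda> M z x"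
    using fy fz by (auto simp: prob_density_def)
  \<comment> \<open>\<open>H\<close> is the product of the two densities divided by
    \<open>f0\<close>, multiplied out, with the products of distinct \<open>\<Lambda> m\<close>
    removed.\<close>
  define H where "H x = (1 - ?ry) * (1 - ?rz) * f0 x +
      ((1 - ?ry) * (\<Sum>m=1..M. z m * \<Lambda> m x) + (1 - ?rz) * (\<Sum>m=1..M. y m * \<Lambda> m x)) +
      (\<Sum>m=1..M. y m * z m * ((\<Lambda> m x)\<^sup>2 / f0 x))" for x
  have 0: "has_bochner_integral \<nu> f0 1"
    using f0n f0i by (intro has_bochner_integral_nn_integral) auto
  have 1: "has_bochner_integral \<nu> (\<Lambda> m) (lam \<nu> \<Lambda> m)" if "m \<in> {1..M}" for m
    using \<Lambda>[OF that] by (simp add: has_bochner_integral_iff lam_def)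
  have 2: "has_bochner_integral \<nu> (\<lambda>x. (\<Lambda> m x)\<^sup>2 / f0 x) (s m)" if "m \<in> {1..M}" for m
    using f0n S[OF that] borel_measurable_integrable[OF \<Lambda>[OF that]]
    by (intro has_bochner_integral_nn_integral) (auto simp: s_def S_int_def)
  have "has_bochner_integral \<nu> H ((1 - ?ry) * (1 - ?rz) * 1 +
      ((1 - ?ry) * (\<Sum>m=1..M. z m * lam \<nu> \<Lambda> m) + (1 - ?rz) * (\<Sum>m=1..M. y m * lam \<nu> \<Lambda> m)) +
      (\<Sum>m=1..M. y m * z m * s m))"
    unfolding H_def
    by (intro has_bochner_integral_add has_bochner_integral_mult_right has_bochner_integral_sum 0 1 2)
       auto
  \<comment> \<open>Both linear sums are values of \<open>rho\<close>. With a and b for these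
    values, (1 - a)(1 - b) + (1 - a) b + (1 - b) a = 1 - a b.\<close>
  moreover have "(1 - ?ry) * (1 - ?rz) * 1 +
      ((1 - ?ry) * (\<Sum>m=1..M. z m * lam \<nu> \<Lambda> m) + (1 - ?rz) * (\<Sum>m=1..M. y m * lam \<nu> \<Lambda> m)) +
      (\<Sum>m=1..M. y m * z m * s m) = 1 - ?ry * ?rz + (\<Sum>m=1..M. y m * z m * s m)"
    unfolding rho_def[symmetric] by (simp add: algebra_simps)
  ultimately have HI: "integrable \<nu> H"
      "integral\<^sup>L \<nu> H = 1 - ?ry * ?rz + (\<Sum>m=1..M. y m * z m * s m)"
    by (auto simp: has_bochner_integral_iff)
  have H: "f_par \<nu> f0 \<Lambda> M y x * f_par \<nu> f0 \<Lambda> M z x / f0 x = H x" if x: "x \<in> space \<nu>" for x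
  proof (cases "f0 x = 0")
    \<comment> \<open>Here every \<open>\<Lambda> m x\<close> is 0 by \<open>vanish\<close>, and
      division by zero yields 0, so both sides are 0.\<close>
    case True
    then show ?thesis using vanish[OF _ x] by (simp add: H_def)
  next
    case False
    have "(\<Sum>m=1..M. y m * \<Lambda> m x) * (\<Sum>m=1..M. z m * \<Lambda> m x) =
        (\<Sum>m=1..M. \<Sum>k=1..M. (y m * \<Lambda> m x) * (z k * \<Lambda> k x))"
      by (rule sum_product)
    also have "\<dots> = (\<Sum>m=1..M. \<Sum>k=1..M. if k = m then y m * z m * (\<Lambda> m x)\<^sup>2 else 0)"
      using orth[OF _ _ _ x] by (intro sum.cong refl) (auto simp: power2_eq_square)
    also have "\<dots> = (\<Sum>m=1..M. y m * z m * (\<Lambda> m x)\<^sup>2)"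
      by simp
    finally have *: "(\<Sum>m=1..M. y m * \<Lambda> m x) * (\<Sum>m=1..M. z m * \<Lambda> m x) = \<dots>" .
    have "f_par \<nu> f0 \<Lambda> M y x * f_par \<nu> f0 \<Lambda> M z x / f0 x =
      (1 - ?ry) * (1 - ?rz) * f0 x +
      ((1 - ?ry) * (\<Sum>m=1..M. z m * \<Lambda> m x) + (1 - ?rz) * (\<Sum>m=1..M. y m * \<Lambda> m x)) +
      (\<Sum>m=1..M. y m * \<Lambda> m x) * (\<Sum>m=1..M. z m * \<Lambda> m x) / f0 x"
      using False by (simp add: f_par_def field_simps)
    also have "\<dots> = H x"
      unfolding * H_def by (simp add: sum_divide_distrib)
    finally show ?thesis .
  qed
  have "(\<integral>\<^sup>+x. ennreal (f_par \<nu> f0 \<Lambda> M y x / f0 x) * ennreal (f_par \<nu> f0 \<Lambda> M z x / f0 x)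
      \<partial>density \<nu> (\<lambda>x. ennreal (f0 x))) = (\<integral>\<^sup>+x. ennreal (H x) \<partial>\<nu>)"
  proof (subst nn_integral_density; (measurable)?)
    show "(\<integral>\<^sup>+x. ennreal (f0 x) * (ennreal (f_par \<nu> f0 \<Lambda> M y x / f0 x) * ennreal (f_par \<nu> f0 \<Lambda> M z x / f0 x))
      \<partial>\<nu>) = (\<integral>\<^sup>+x. ennreal (H x) \<partial>\<nu>)"
    proof (rule nn_integral_cong)
      fix x assume x: "x \<in> space \<nu>"
      have "ennreal (f0 x) * (ennreal (f_par \<nu> f0 \<Lambda> M y x / f0 x) * ennreal (f_par \<nu> f0 \<Lambda> M z x / f0 x)) =
        ennreal (f0 x * (f_par \<nu> f0 \<Lambda> M y x / f0 x * (f_par \<nu> f0 \<Lambda> M z x / f0 x)))"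
        using f0n[OF x] nonneg[OF x] by (simp flip: ennreal_mult)
      also have "f0 x * (f_par \<nu> f0 \<Lambda> M y x / f0 x * (f_par \<nu> f0 \<Lambda> M z x / f0 x)) = H x"
        using H[OF x] by (cases "f0 x = 0") (auto simp: field_simps)
      finally show "ennreal (f0 x) * (ennreal (f_par \<nu> f0 \<Lambda> M y x / f0 x) * ennreal (f_par \<nu> f0 \<Lambda> M z x / f0 x)) =
        ennreal (H x)" .
    qed
  qed
  \<comment> \<open>\<open>H\<close> has signed summands but is nonnegative as a whole, being a
    quotient of densities, so its two integrals agree.\<close>
  also have "\<dots> = ennreal (integral\<^sup>L \<nu> H)"
    using HI(1) H[symmetric] f0n nonneg by (intro nn_integral_eq_integral AE_I2) auto
  also have "\<dots> \<le> ennreal (exp (\<Sum>m=1..M. y m * z m * s m))"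
    unfolding HI(2) using rho exp_ge_add_one_self[of "\<Sum>m=1..M. y m * z m * s m"]
    by (intro ennreal_leI) linarith
  finally show ?thesis unfolding s_def .
qed

section \<open>Factorization over the coordinates of the prior\<close>

lemma prob_on_measurable:
  assumes "prob_on Y P"
  shows "prob_space P" "(\<lambda>u. u) \<in> borel_measurable P" "space P = Y"
proof -
  show "prob_space P" using assms by (simp add: prob_on_def)
  have *: "sets P = sets (restrict_space borel Y)" using assms by (simp add: prob_on_def)
  then show "(\<lambda>u. u) \<in> borel_measurable P"
    by (simp add: measurable_cong_sets[OF * refl] measurable_restrict_space1)
  show "space P = Y" using sets_eq_imp_space_eq[OF *] by (simp add: space_restrict_space)
qed

text \<open>With \<open>y\<close> fixed, the inner integral splits over the independent coordinates
  of \<open>z\<close>; the result is again a product, now over the coordinates of \<open>y\<close>,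
  and splits in the same way.\<close>

lemma nn_integral_PiM_pair_prod:
  assumes "finite I" "prob_space P"
    and k: "\<And>i. i \<in> I \<Longrightarrow> case_prod (k i) \<in> borel_measurable (P \<Otimes>\<^sub>M P)"
  shows "(\<integral>\<^sup>+y. (\<integral>\<^sup>+z. (\<Prod>i\<in>I. k i (y i) (z i)) \<partial>(\<Pi>\<^sub>M i\<in>I. P)) \<partial>(\<Pi>\<^sub>M i\<in>I. P)) =
    (\<Prod>i\<in>I. \<integral>\<^sup>+u. (\<integral>\<^sup>+v. k i u v \<partial>P) \<partial>P)"
proof -
  interpret P1: prob_space P by fact
  interpret PI: product_prob_space "\<lambda>_. P" I
    using assms(2) by (intro product_prob_spaceI)
  have "(\<integral>\<^sup>+y. (\<integral>\<^sup>+z. (\<Prod>i\<in>I. k i (y i) (z i)) \<partial>(\<Pi>\<^sub>M i\<in>I. P)) \<partial>(\<Pi>\<^sub>M i\<in>I. P)) =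
     (\<integral>\<^sup>+y. (\<Prod>i\<in>I. \<integral>\<^sup>+v. k i (y i) v \<partial>P) \<partial>(\<Pi>\<^sub>M i\<in>I. P))"
  proof (intro nn_integral_cong PI.product_nn_integral_prod assms(1))
    fix y i assume "y \<in> space (\<Pi>\<^sub>M i\<in>I. P)" "i \<in> I"
    then have "y i \<in> space P" by (auto simp: space_PiM)
    from measurable_compose[OF measurable_Pair1'[OF this] k[OF \<open>i \<in> I\<close>]]
    show "k i (y i) \<in> borel_measurable P" by simp
  qed
  also have "\<dots> = (\<Prod>i\<in>I. \<integral>\<^sup>+u. (\<integral>\<^sup>+v. k i u v \<partial>P) \<partial>P)"
    using k by (intro PI.product_nn_integral_prod assms(1) P1.borel_measurable_nn_integral)
  finally show ?thesis .
qed

text \<open>The power \<open>n\<close> scales the exponent, and the exponential turns the sum over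
  \<open>m\<close> into a product of functions of independent coordinate pairs.\<close>

lemma prod_exp_moment:
  assumes P: "prob_space P" "(\<lambda>u. u) \<in> borel_measurable P"
    and S: "\<And>m. m \<in> {1..M} \<Longrightarrow> S m < \<infinity>"
  shows "(\<integral>\<^sup>+y. (\<integral>\<^sup>+z. ennreal (exp (\<Sum>m=1..M. y m * z m * enn2real (S m))) ^ n
      \<partial>prod_prob P M) \<partial>prod_prob P M) = (\<Prod>m=1..M. exp_moment P 1 n (S m))"
proof -
  note [measurable] = P(2)
  have "exp_moment P 1 n (S m) =
      (\<integral>\<^sup>+u. (\<integral>\<^sup>+v. ennreal (exp (real n * (u * v * enn2real (S m)))) \<partial>P) \<partial>P)"
    if m: "m \<in> {1..M}" for m
  proof -
    \<comment> \<open>Finiteness of \<open>S m\<close> makes the extended-real exponent a real one;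
      the exchanged roles of \<open>u\<close> and \<open>v\<close> are absorbed by the symmetry of
      \<open>u * v\<close>.\<close>
    obtain s where s: "0 \<le> s" "S m = ennreal s" using S[OF m] by (cases "S m") auto
    show ?thesis
      unfolding exp_moment_def
      using s by (simp add: exp_ereal_def enn2ereal_ennreal ac_simps)
  qed
  then have "(\<Prod>m=1..M. exp_moment P 1 n (S m)) =
      (\<Prod>m=1..M. \<integral>\<^sup>+u. (\<integral>\<^sup>+v. ennreal (exp (real n * (u * v * enn2real (S m)))) \<partial>P) \<partial>P)"
    by (intro prod.cong) auto
  also have "\<dots> = (\<integral>\<^sup>+y. (\<integral>\<^sup>+z. (\<Prod>m=1..M. ennreal (exp (real n * (y m * z m * enn2real (S m)))))
      \<partial>prod_prob P M) \<partial>prod_prob P M)"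
    unfolding prod_prob_def
    by (intro nn_integral_PiM_pair_prod[symmetric] P(1)) (auto simp: case_prod_beta')
  also have "(\<lambda>y z. \<Prod>m=1..M. ennreal (exp (real n * (y m * z m * enn2real (S m))))) =
      (\<lambda>y z. ennreal (exp (\<Sum>m=1..M. y m * z m * enn2real (S m))) ^ n)"
    by (simp add: prod_ennreal ennreal_power exp_of_nat_mult[symmetric] flip: exp_sum sum_distrib_left)
  finally show ?thesis by simp
qed

section \<open>Sample laws and quadratic risk\<close>

lemma prob_space_density_law:
  assumes "prob_density \<nu> f"
  shows "prob_space (density \<nu> (\<lambda>x. ennreal (f x)))"
  using assms by (intro prob_spaceI) (auto simp: prob_density_def emeasure_density cong: nn_integral_cong)

lemma prob_space_sample_law:
  assumes "prob_density \<nu> f"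
  shows "prob_space (sample_law \<nu> n f)"
  unfolding sample_law_def by (intro prob_space_PiM prob_space_density_law assms)

lemma sets_sample_law [measurable_cong]: "sets (sample_law \<nu> n f) = sets (\<Pi>\<^sub>M i\<in>{1..n}. \<nu>)"
  unfolding sample_law_def by (intro sets_PiM_cong) auto

text \<open>On one coordinate, \<open>f x = f0 x * (f x / f0 x)\<close> holds also at the zeros of
  \<open>f0\<close>, by \<open>ac\<close>. The product formula for densities lifts this change of
  reference to the sample.\<close>

lemma sample_law_eq_density:
  assumes f0: "prob_density \<nu> f0" and f: "prob_density \<nu> f"
    and ac: "\<And>x. x \<in> space \<nu> \<Longrightarrow> f0 x = 0 \<Longrightarrow> f x = 0"
  shows "sample_law \<nu> n f = density (sample_law \<nu> n f0) (\<lambda>x. \<Prod>i=1..n. ennreal (f (x i) / f0 (x i)))"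
proof -
  have [measurable]: "f0 \<in> borel_measurable \<nu>" "f \<in> borel_measurable \<nu>"
    and nonneg: "\<And>x. x \<in> space \<nu> \<Longrightarrow> 0 \<le> f0 x" "\<And>x. x \<in> space \<nu> \<Longrightarrow> 0 \<le> f x"
    using f0 f by (auto simp: prob_density_def)
  have "density \<nu> (\<lambda>x. ennreal (f x)) =
      density \<nu> (\<lambda>x. ennreal (f0 x) * ennreal (f x / f0 x))"
    using nonneg ac by (intro density_cong AE_I2) (auto simp flip: ennreal_mult)
  also have "\<dots> = density (density \<nu> (\<lambda>x. ennreal (f0 x))) (\<lambda>x. ennreal (f x / f0 x))"
    by (subst density_density_eq) auto
  finally have *: "density \<nu> (\<lambda>x. ennreal (f x)) =
      density (density \<nu> (\<lambda>x. ennreal (f0 x))) (\<lambda>x. ennreal (f x / f0 x))" .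
  show ?thesis
    unfolding sample_law_def *
    using prob_space_density_law[OF f0] prob_space_density_law[OF f, unfolded *]
    by (intro PiM_density) auto
qed

lemma ennreal_sqrt_power2 [simp]: "(ennreal_sqrt x)\<^sup>2 = x"
proof (cases x)
  case (real r)
  then show ?thesis by (simp add: ennreal_sqrt_def ennreal_power)
next
  case top
  then show ?thesis by (simp add: ennreal_sqrt_def power2_eq_square ennreal_top_mult)
qed

text \<open>Markov's inequality for the squared error, which is at least \<open>a\<^sup>2\<close> on
  \<open>A\<close>. The weight \<open>b\<close> is free because the two classes enter with different
  weights; a negative \<open>b\<close> is sent to 0 by \<open>ennreal\<close>.\<close>

lemma Chebyshev_le_risk:
  assumes "f \<in> F" "T \<in> estimators \<nu> n" "A \<in> sets (sample_law \<nu> n f)" "0 < a"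
    and "\<And>x. x \<in> A \<Longrightarrow> a \<le> \<bar>T x - real_of_ereal (\<Phi> f)\<bar>"
  shows "ennreal b * emeasure (sample_law \<nu> n f) A \<le> ennreal (b / a\<^sup>2) * (risk \<nu> \<Phi> n T F)\<^sup>2"
proof (cases "0 \<le> b")
  case True
  have "ennreal (a\<^sup>2) * emeasure (sample_law \<nu> n f) A =
      (\<integral>\<^sup>+x. ennreal (a\<^sup>2) * indicator A x \<partial>sample_law \<nu> n f)"
    using assms(3) by (simp add: nn_integral_cmult)
  also have "\<dots> \<le> (\<integral>\<^sup>+x. ennreal ((T x - real_of_ereal (\<Phi> f))\<^sup>2) \<partial>sample_law \<nu> n f)"
  proof (intro nn_integral_mono)
    fix x
    have "x \<in> A \<Longrightarrow> a\<^sup>2 \<le> (T x - real_of_ereal (\<Phi> f))\<^sup>2"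
      using assms(4) assms(5)[of x] by (simp add: abs_le_square_iff[symmetric])
    then show "ennreal (a\<^sup>2) * indicator A x \<le> ennreal ((T x - real_of_ereal (\<Phi> f))\<^sup>2)"
      by (auto split: split_indicator)
  qed
  \<comment> \<open>The integral is the square of its root, and that root is one of the terms in the
    supremum defining \<open>risk\<close>.\<close>
  also have "\<dots> \<le> (risk \<nu> \<Phi> n T F)\<^sup>2"
    by (subst ennreal_sqrt_power2[symmetric], intro power_mono)
       (auto simp: risk_def intro!: SUP_upper assms(1))
  finally have *: "ennreal (a\<^sup>2) * emeasure (sample_law \<nu> n f) A \<le> (risk \<nu> \<Phi> n T F)\<^sup>2" .
  have "ennreal b * emeasure (sample_law \<nu> n f) A =
     ennreal (b / a\<^sup>2) * (ennreal (a\<^sup>2) * emeasure (sample_law \<nu> n f) A)"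
    using True assms(4) by (simp flip: ennreal_mult mult.assoc)
  also have "\<dots> \<le> ennreal (b / a\<^sup>2) * (risk \<nu> \<Phi> n T F)\<^sup>2"
    using * by (rule mult_left_mono) auto
  finally show ?thesis .
qed (simp add: ennreal_neg)

text \<open>Parameter and observation enter through arbitrary measurable maps, so that joint
  measurability on the product of prior and sample space follows for each single
  observation.\<close>

lemma measurable_f_par:
  assumes f0: "f0 \<in> borel_measurable \<nu>"
    and \<Lambda>: "\<And>m. m \<in> {1..M} \<Longrightarrow> \<Lambda> m \<in> borel_measurable \<nu>"
    and P: "(\<lambda>u. u) \<in> borel_measurable P"
    and y: "g \<in> measurable L (prod_prob P M)" and x: "h \<in> measurable L \<nu>"
  shows "(\<lambda>w. f_par \<nu> f0 \<Lambda> M (g w) (h w)) \<in> borel_measurable L"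
proof -
  have [measurable]: "(\<lambda>w. g w m) \<in> borel_measurable L" if "m \<in> {1..M}" for m
    using measurable_compose[OF measurable_compose[OF y[unfolded prod_prob_def]
      measurable_component_singleton[OF that]] P] by simp
  have [measurable]: "(\<lambda>w. f0 (h w)) \<in> borel_measurable L"
    using measurable_compose[OF x f0] .
  have [measurable]: "(\<lambda>w. \<Lambda> m (h w)) \<in> borel_measurable L" if "m \<in> {1..M}" for m
    using measurable_compose[OF x \<Lambda>[OF that]] .
  show ?thesis unfolding f_par_def rho_def by measurable
qed

section \<open>The risk inequality at a fixed sample size\<close>

text \<open>The nonasymptotic core. The level \<open>t\<close> stays free; it balances the risk over
  \<open>F\<close>, weighted by \<open>t\<close>, against the second moment, weighted by
  \<open>1 / t\<close>.\<close>

lemma two_class_risk_bound: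
  assumes F: "F \<subseteq> admissible_densities \<nu> \<Phi>" and G: "G \<subseteq> admissible_densities \<nu> \<Phi>"
    and f0: "f0 \<in> F"
    and P: "prob_on Y P"
    and \<Lambda>: "\<And>m. m \<in> {1..M} \<Longrightarrow> integrable \<nu> (\<Lambda> m)"
    and vanish: "\<And>m x. m \<in> {1..M} \<Longrightarrow> x \<in> space \<nu> \<Longrightarrow> f0 x = 0 \<Longrightarrow> \<Lambda> m x = 0"
    and orth: "\<And>m k x. m \<in> {1..M} \<Longrightarrow> k \<in> {1..M} \<Longrightarrow> m \<noteq> k \<Longrightarrow> x \<in> space \<nu> \<Longrightarrow> \<Lambda> m x * \<Lambda> k x = 0"
    and S: "\<And>m. m \<in> {1..M} \<Longrightarrow> S_int \<nu> f0 \<Lambda> m < \<infinity>"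
    and rho: "\<And>y z. y \<in> cube Y M \<Longrightarrow> z \<in> cube Y M \<Longrightarrow> 0 \<le> rho \<nu> \<Lambda> M y * rho \<nu> \<Lambda> M z"
    and BG: "measure (prod_prob P M) (Y_class \<nu> f0 \<Lambda> M Y G) \<ge> 230 / 231"
    and BF: "measure (prod_prob P M) (Y_func \<nu> \<Phi> f0 \<Lambda> M Y \<psi>) \<ge> 230 / 231"
    and \<psi>: "0 < \<psi>" and t: "0 < t" and T: "T \<in> estimators \<nu> n"
  shows "ennreal (229 / 231) \<le> ennreal (t / \<psi>\<^sup>2) * (risk \<nu> \<Phi> n T F)\<^sup>2 +
      ennreal (1 / \<psi>\<^sup>2) * (risk \<nu> \<Phi> n T G)\<^sup>2 +
      ennreal (1 / t) * (\<Prod>m=1..M. exp_moment P 1 n (S_int \<nu> f0 \<Lambda> m))"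
proof -
  define R where "R = prod_prob P M"
  define B where "B = Y_class \<nu> f0 \<Lambda> M Y G \<inter> Y_func \<nu> \<Phi> f0 \<Lambda> M Y \<psi>"
  define N where "N = sample_law \<nu> n f0"
  define q where "q y x = (\<Prod>i=1..n. ennreal (f_par \<nu> f0 \<Lambda> M y (x i) / f0 (x i)))" for y x
  define \<theta> where "\<theta> = real_of_ereal (\<Phi> f0)"
  define D where "D = {x\<in>space N. \<psi> \<le> \<bar>T x - \<theta>\<bar>}"
  note PP = prob_on_measurable[OF P]
  have pf0: "prob_density \<nu> f0" and \<Phi>0: "\<bar>\<Phi> f0\<bar> < \<infinity>"
    using f0 F by (auto simp: admissible_densities_def)
  interpret R: prob_space R
    unfolding R_def prod_prob_def by (intro prob_space_PiM PP)
  interpret N: prob_space N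
    unfolding N_def by (intro prob_space_sample_law pf0)
  have sN [measurable_cong]: "sets N = sets (\<Pi>\<^sub>M i\<in>{1..n}. \<nu>)"
    by (simp add: N_def sets_sample_law)
  have TN [measurable]: "T \<in> borel_measurable N"
    using T by (simp add: estimators_def measurable_cong_sets[OF sN refl])
  have D [measurable]: "D \<in> sets N" unfolding D_def by measurable
  have BGs: "Y_class \<nu> f0 \<Lambda> M Y G \<in> sets R" and BFs: "Y_func \<nu> \<Phi> f0 \<Lambda> M Y \<psi> \<in> sets R"
    using BG BF measure_notin_sets[of "Y_class \<nu> f0 \<Lambda> M Y G" R]
      measure_notin_sets[of "Y_func \<nu> \<Phi> f0 \<Lambda> M Y \<psi>" R] by (auto simp: R_def)
  then have B [measurable]: "B \<in> sets R" by (simp add: B_def)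
  \<comment> \<open>Each of the two complements has mass at most 1/231, so the intersection loses at
    most 2/231.\<close>
  have "measure R (space R - B) \<le>
      measure R (space R - Y_class \<nu> f0 \<Lambda> M Y G) + measure R (space R - Y_func \<nu> \<Phi> f0 \<Lambda> M Y \<psi>)"
    unfolding B_def Diff_Int using BGs BFs by (intro measure_Un_le) auto
  then have "229 / 231 \<le> measure R B"
    using BG[folded R_def] BF[folded R_def] BGs BFs B by (simp add: R.prob_compl)
  then have massB: "ennreal (229 / 231) \<le> emeasure R B"
    by (simp add: R.emeasure_eq_measure)
  have inB: "y \<in> cube Y M" "f_par \<nu> f0 \<Lambda> M y \<in> G" "prob_density \<nu> (f_par \<nu> f0 \<Lambda> M y)"
      "2 * \<psi> < \<bar>real_of_ereal (\<Phi> (f_par \<nu> f0 \<Lambda> M y)) - \<theta>\<bar>" if "y \<in> B" for y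
  proof -
    show *: "y \<in> cube Y M" "f_par \<nu> f0 \<Lambda> M y \<in> G"
      using that by (auto simp: B_def Y_class_def)
    then show "prob_density \<nu> (f_par \<nu> f0 \<Lambda> M y)"
      using G by (auto simp: admissible_densities_def)
    have "\<bar>\<Phi> (f_par \<nu> f0 \<Lambda> M y)\<bar> < \<infinity>"
      using * G by (auto simp: admissible_densities_def)
    moreover have "\<bar>\<Phi> (f_par \<nu> f0 \<Lambda> M y) - \<Phi> f0\<bar> > ereal (2 * \<psi>)"
      using that by (auto simp: B_def Y_func_def)
    \<comment> \<open>\<open>\<Phi>\<close> is finite at both densities, so the extended-real
      separation passes to real numbers.\<close>
    ultimately show "2 * \<psi> < \<bar>real_of_ereal (\<Phi> (f_par \<nu> f0 \<Lambda> M y)) - \<theta>\<bar>"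
      using \<Phi>0 by (cases "\<Phi> (f_par \<nu> f0 \<Lambda> M y)"; cases "\<Phi> f0") (auto simp: \<theta>_def)
  qed
  have f0m: "f0 \<in> borel_measurable \<nu>" using pf0 by (simp add: prob_density_def)
  note \<Lambda>m = borel_measurable_integrable[OF \<Lambda>]
  have q: "case_prod q \<in> borel_measurable (R \<Otimes>\<^sub>M N)"
  proof -
    have [measurable]: "(\<lambda>w. snd w i) \<in> measurable (R \<Otimes>\<^sub>M N) \<nu>" if "i \<in> {1..n}" for i
      using that by measurable
    have [measurable]: "(\<lambda>w. f_par \<nu> f0 \<Lambda> M (fst w) (snd w i)) \<in> borel_measurable (R \<Otimes>\<^sub>M N)"
      if [measurable]: "i \<in> {1..n}" for i
      using f0m \<Lambda>m PP(2) by (rule measurable_f_par) (auto simp flip: R_def)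
    have [measurable]: "(\<lambda>w. f0 (snd w i)) \<in> borel_measurable (R \<Otimes>\<^sub>M N)" if [measurable]: "i \<in> {1..n}" for i
      by (rule measurable_compose[OF _ f0m]) measurable
    show ?thesis unfolding q_def case_prod_beta' by measurable
  qed
  have qm [measurable]: "q y \<in> borel_measurable N" if "y \<in> space R" for y
    using measurable_compose[OF measurable_Pair1'[OF that] q] by simp
  have BR: "y \<in> space R" if "y \<in> B" for y using sets.sets_into_space[OF B] that by auto
  \<comment> \<open>At a zero of \<open>f0\<close> both parts of \<open>f_par\<close> vanish, so the
    law at \<open>y\<close> is absolutely continuous with respect to \<open>N\<close>.\<close>
  have law: "sample_law \<nu> n (f_par \<nu> f0 \<Lambda> M y) = density N (q y)" if "y \<in> B" for y
    unfolding N_def q_def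
    by (intro sample_law_eq_density pf0 inB that) (auto simp: f_par_def vanish)
  have mass: "(\<integral>\<^sup>+x. q y x \<partial>N) = 1" if y: "y \<in> B" for y
  proof -
    have "prob_space (density N (q y))"
      using prob_space_sample_law[OF inB(3)[OF y], of n] law[OF y] by simp
    from prob_space.emeasure_space_1[OF this] show ?thesis
      using qm[OF BR[OF y]] by (simp add: emeasure_density cong: nn_integral_cong)
  qed
  \<comment> \<open>Membership in \<open>B\<close> guarantees that both members of the family are
    densities. Independence raises the cross moment of one observation to the power
    \<open>n\<close>.\<close>
  have cross: "(\<integral>\<^sup>+x. q y x * q z x \<partial>N) \<le>
      ennreal (exp (\<Sum>m=1..M. y m * z m * enn2real (S_int \<nu> f0 \<Lambda> m))) ^ n"
    if y: "y \<in> B" and z: "z \<in> B" for y z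
  proof -
    let ?N = "density \<nu> (\<lambda>x. ennreal (f0 x))"
    let ?g = "\<lambda>x. ennreal (f_par \<nu> f0 \<Lambda> M y x / f0 x) * ennreal (f_par \<nu> f0 \<Lambda> M z x / f0 x)"
    interpret N1: product_prob_space "\<lambda>_. ?N" "{1..n}"
      by (intro product_prob_spaceI prob_space_density_law pf0)
    have [measurable]: "f_par \<nu> f0 \<Lambda> M y \<in> borel_measurable \<nu>" "f_par \<nu> f0 \<Lambda> M z \<in> borel_measurable \<nu>"
      using inB(3)[OF y] inB(3)[OF z] by (auto simp: prob_density_def)
    note [measurable] = f0m
    have "(\<integral>\<^sup>+x. q y x * q z x \<partial>N) = (\<integral>\<^sup>+x. (\<Prod>i=1..n. ?g (x i)) \<partial>(\<Pi>\<^sub>M i\<in>{1..n}. ?N))"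
      by (simp add: N_def sample_law_def q_def prod.distrib)
    also have "\<dots> = (\<Prod>i=1..n. \<integral>\<^sup>+x. ?g x \<partial>?N)"
      by (rule N1.product_nn_integral_prod) auto
    also have "\<dots> = (\<integral>\<^sup>+x. ?g x \<partial>?N) ^ n"
      by simp
    also have "\<dots> \<le> ennreal (exp (\<Sum>m=1..M. y m * z m * enn2real (S_int \<nu> f0 \<Lambda> m))) ^ n"
      using y z by (intro power_mono likelihood_cross_moment_le pf0 \<Lambda> vanish orth S rho inB) auto
    finally show ?thesis .
  qed
  have "ennreal (229 / 231) \<le> (\<integral>\<^sup>+y\<in>B. (\<integral>\<^sup>+x. q y x \<partial>N) \<partial>R)"
  proof -
    have "(\<integral>\<^sup>+y\<in>B. (\<integral>\<^sup>+x. q y x \<partial>N) \<partial>R) = (\<integral>\<^sup>+y. indicator B y \<partial>R)"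
      using mass by (intro nn_integral_cong) (auto split: split_indicator)
    then show ?thesis using massB by simp
  qed
  also have "\<dots> \<le> ennreal t * emeasure N D + (\<integral>\<^sup>+y\<in>B. (\<integral>\<^sup>+x\<in>space N - D. q y x \<partial>N) \<partial>R) +
     ennreal (1 / t) * (\<integral>\<^sup>+y\<in>B. (\<integral>\<^sup>+z\<in>B. (\<integral>\<^sup>+x. q y x * q z x \<partial>N) \<partial>R) \<partial>R)"
    by (intro mixture_second_moment_bound q R.prob_space_axioms N.prob_space_axioms B D t)
  also have "\<dots> \<le> ennreal (t / \<psi>\<^sup>2) * (risk \<nu> \<Phi> n T F)\<^sup>2 +
      ennreal (1 / \<psi>\<^sup>2) * (risk \<nu> \<Phi> n T G)\<^sup>2 +
      ennreal (1 / t) * (\<Prod>m=1..M. exp_moment P 1 n (S_int \<nu> f0 \<Lambda> m))"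
  proof (intro add_mono mult_left_mono)
    show "ennreal t * emeasure N D \<le> ennreal (t / \<psi>\<^sup>2) * (risk \<nu> \<Phi> n T F)\<^sup>2"
      unfolding N_def by (rule Chebyshev_le_risk[OF f0 T _ \<psi>])
        (use D in \<open>auto simp: N_def D_def \<theta>_def\<close>)
    \<comment> \<open>Off \<open>D\<close> the estimate lies within \<open>\<psi>\<close> of
      \<open>\<theta>\<close>, while the functional at the density of \<open>y\<close> is more than
      \<open>2 * \<psi>\<close> away from \<open>\<theta>\<close>. By the triangle inequality the
      estimator then errs by at least \<open>\<psi>\<close>.\<close>
    have "(\<integral>\<^sup>+x\<in>space N - D. q y x \<partial>N) \<le> ennreal (1 / \<psi>\<^sup>2) * (risk \<nu> \<Phi> n T G)\<^sup>2"
      if y: "y \<in> B" for y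
    proof -
      have "(\<integral>\<^sup>+x\<in>space N - D. q y x \<partial>N) = ennreal 1 * emeasure (sample_law \<nu> n (f_par \<nu> f0 \<Lambda> M y)) (space N - D)"
        using qm[OF BR[OF y]] D by (simp add: law[OF y] emeasure_density)
      also have "\<dots> \<le> ennreal (1 / \<psi>\<^sup>2) * (risk \<nu> \<Phi> n T G)\<^sup>2"
        by (rule Chebyshev_le_risk[OF inB(2)[OF y] T _ \<psi>])
           (use D inB(4)[OF y] in \<open>auto simp: D_def law[OF y]\<close>)
      finally show ?thesis .
    qed
    then have "(\<integral>\<^sup>+y\<in>B. (\<integral>\<^sup>+x\<in>space N - D. q y x \<partial>N) \<partial>R) \<le>
        (\<integral>\<^sup>+y. ennreal (1 / \<psi>\<^sup>2) * (risk \<nu> \<Phi> n T G)\<^sup>2 \<partial>R)"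
      by (intro nn_integral_mono) (auto split: split_indicator)
    then show "(\<integral>\<^sup>+y\<in>B. (\<integral>\<^sup>+x\<in>space N - D. q y x \<partial>N) \<partial>R) \<le> ennreal (1 / \<psi>\<^sup>2) * (risk \<nu> \<Phi> n T G)\<^sup>2"
      by (simp add: R.emeasure_space_1)
    have "(\<integral>\<^sup>+y\<in>B. (\<integral>\<^sup>+z\<in>B. (\<integral>\<^sup>+x. q y x * q z x \<partial>N) \<partial>R) \<partial>R) \<le>
      (\<integral>\<^sup>+y. (\<integral>\<^sup>+z. ennreal (exp (\<Sum>m=1..M. y m * z m * enn2real (S_int \<nu> f0 \<Lambda> m))) ^ n \<partial>R) \<partial>R)"
    proof (rule nn_integral_mono)
      fix y
      show "(\<integral>\<^sup>+z\<in>B. (\<integral>\<^sup>+x. q y x * q z x \<partial>N) \<partial>R) * indicator B y \<le>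
        (\<integral>\<^sup>+z. ennreal (exp (\<Sum>m=1..M. y m * z m * enn2real (S_int \<nu> f0 \<Lambda> m))) ^ n \<partial>R)"
      proof (cases "y \<in> B")
        case True
        then show ?thesis
          using cross[OF True] by (auto intro!: nn_integral_mono split: split_indicator)
      qed simp
    qed
    then show "(\<integral>\<^sup>+y\<in>B. (\<integral>\<^sup>+z\<in>B. (\<integral>\<^sup>+x. q y x * q z x \<partial>N) \<partial>R) \<partial>R) \<le>
      (\<Prod>m=1..M. exp_moment P 1 n (S_int \<nu> f0 \<Lambda> m))"
      unfolding R_def using prod_exp_moment[OF PP(1,2) S] by simp
  qed simp
  finally show ?thesis .
qed

section \<open>Finiteness of the integrals \<open>S_int\<close>\<close>

text \<open>Under the point mass at 0, almost surely all coordinates of \<open>y\<close> are 0 and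
  \<open>f_par\<close> returns \<open>f0\<close>. Finiteness of \<open>\<Phi> f0\<close> then makes
  the difference of functional values 0; in \<open>ereal\<close> a difference of equal infinities
  would be infinite.\<close>

lemma separated_imp_nondegenerate:
  assumes P: "prob_on Y P" and \<Phi>: "\<bar>\<Phi> f0\<bar> < \<infinity>" and \<psi>: "0 \<le> \<psi>"
    and pos: "0 < measure (prod_prob P M) (Y_func \<nu> \<Phi> f0 \<Lambda> M Y \<psi>)"
  shows "\<not> (AE u in P. u = 0)"
proof
  assume *: "AE u in P. u = 0"
  interpret R: prob_space "prod_prob P M"
    unfolding prod_prob_def by (intro prob_space_PiM prob_on_measurable[OF P])
  have meas: "Y_func \<nu> \<Phi> f0 \<Lambda> M Y \<psi> \<in> sets (prod_prob P M)"
    using pos measure_notin_sets by force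
  have "AE y in prod_prob P M. \<forall>m\<in>{1..M}. y m = 0"
    using * prob_on_measurable(1)[OF P] unfolding prod_prob_def
    by (intro AE_finite_allI AE_PiM_component) auto
  then have "AE y in prod_prob P M. y \<notin> Y_func \<nu> \<Phi> f0 \<Lambda> M Y \<psi>"
  proof eventually_elim
    fix y :: "nat \<Rightarrow> real" assume y: "\<forall>m\<in>{1..M}. y m = 0"
    then have "f_par \<nu> f0 \<Lambda> M y = f0"
      by (simp add: f_par_def rho_def fun_eq_iff)
    then show "y \<notin> Y_func \<nu> \<Phi> f0 \<Lambda> M Y \<psi>"
      using \<Phi> \<psi> by (cases "\<Phi> f0") (auto simp: Y_func_def)
  qed
  with pos show False using R.prob_eq_0[OF meas] by simp
qed

text \<open>An infinite \<open>S m\<close> gives an infinite factor. Since 0 times infinity is 0 in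
  \<open>ennreal\<close>, the other factors must be known to be nonzero; nondegeneracy of
  \<open>P\<close> provides both facts.\<close>

lemma finite_prod_exp_moment_imp_S_finite:
  fixes M :: nat
  assumes P: "prob_on Y P" and ne: "\<not> (AE u in P. u = 0)" and n: "0 < n"
    and fin: "(\<Prod>m=1..M. exp_moment P 1 n (S m)) < \<infinity>" and m: "m \<in> {1..M}"
  shows "S m < \<infinity>"
proof (rule ccontr)
  assume "\<not> S m < \<infinity>"
  then have "S m = \<infinity>" by (simp flip: less_top)
  then have "exp_moment P 1 n (S m) = \<infinity>"
    using exp_moment_bounds(2)[OF prob_on_measurable(1,2)[OF P] ne _ n] by simp
  moreover have "(\<Prod>k\<in>{1..M} - {m}. exp_moment P 1 n (S k)) \<noteq> 0"
    using exp_moment_bounds(1)[OF prob_on_measurable(1,2)[OF P] ne] by simp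
  moreover have "(\<Prod>k=1..M. exp_moment P 1 n (S k)) =
      exp_moment P 1 n (S m) * (\<Prod>k\<in>{1..M} - {m}. exp_moment P 1 n (S k))"
    using m by (intro prod.remove) auto
  ultimately show False using fin by (simp add: ennreal_top_mult)
qed

section \<open>Choice of the truncation level and passage to the limit\<close>

theorem theorem2:
  fixes \<nu> :: "'a measure"
    and \<Phi> :: "('a \<Rightarrow> real) \<Rightarrow> ereal"
    and F G :: "('a \<Rightarrow> real) set"
    and \<phi>F \<phi>G \<psi> :: "nat \<Rightarrow> real"
    and c :: real
    and f0 :: "nat \<Rightarrow> 'a \<Rightarrow> real"
    and M :: "nat \<Rightarrow> nat"
    and \<Lambda> :: "nat \<Rightarrow> nat \<Rightarrow> 'a \<Rightarrow> real"
    and Y :: "nat \<Rightarrow> real set"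
    and P :: "nat \<Rightarrow> real measure"
    and Q :: "nat \<Rightarrow> nat \<Rightarrow> 'a set"
  assumes classes: "F \<subseteq> admissible_densities \<nu> \<Phi>" "G \<subseteq> admissible_densities \<nu> \<Phi>"
    and rates: "minimax_rate \<nu> \<Phi> F \<phi>F" "minimax_rate \<nu> \<Phi> G \<phi>G"
    and c: "0 < c" "c < 1"
    and alpha: "filterlim (alpha_ratio \<phi>G \<phi>F c) at_top sequentially"
    and M: "\<And>n. 1 \<le> n \<Longrightarrow> 1 \<le> M n"
    and \<Lambda>: "\<And>n m. 1 \<le> n \<Longrightarrow> m \<in> {1..M n} \<Longrightarrow>
      \<Lambda> n m \<in> borel_measurable \<nu> \<and> integrable \<nu> (\<lambda>x. (\<Lambda> n m x)\<^sup>2) \<and> integrable \<nu> (\<Lambda> n m)"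
    and Y: "\<And>n. 1 \<le> n \<Longrightarrow> is_interval (Y n)"
    and P: "\<And>n. 1 \<le> n \<Longrightarrow> prob_on (Y n) (P n)"
    and supports: "\<And>n. 1 \<le> n \<Longrightarrow> disjoint_family_on (Q n) {1..M n}"
      "\<And>n m. 1 \<le> n \<Longrightarrow> m \<in> {1..M n} \<Longrightarrow> Q n m \<in> sets \<nu> \<and> supp_on \<nu> (\<Lambda> n m) = Q n m"
    and f0: "\<And>n. 1 \<le> n \<Longrightarrow> f0 n \<in> F"
      "\<And>n x. 1 \<le> n \<Longrightarrow> x \<in> (\<Union>m\<in>{1..M n}. Q n m) \<Longrightarrow> 0 < f0 n x"
    and in_class: "\<And>n. 1 \<le> n \<Longrightarrow>
      measure (prod_prob (P n) (M n)) (Y_class \<nu> (f0 n) (\<Lambda> n) (M n) (Y n) G) \<ge> 230 / 231"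
    and \<psi>: "\<psi> \<longlonglongrightarrow> 0" "filterlim (\<lambda>n. \<psi> n / \<phi>G n) at_top sequentially"
    and separated: "\<forall>\<^sub>F n in sequentially.
      measure (prod_prob (P n) (M n)) (Y_func \<nu> \<Phi> (f0 n) (\<Lambda> n) (M n) (Y n) (\<psi> n)) \<ge> 230 / 231"
    and alternatives:
      "(\<forall>n\<ge>1. (\<forall>m\<in>{1..M n}. lam \<nu> (\<Lambda> n) m = 0) \<and>
          Y_plus \<nu> (f0 n) (\<Lambda> n) (M n) (Y n) = cube (Y n) (M n)) \<or>
       (\<forall>n\<ge>1. cube (Y n) (M n) \<subseteq> cube {0..1} (M n) \<and>
          (\<forall>m\<in>{1..M n}. \<forall>x\<in>space \<nu>. 0 \<le> \<Lambda> n m x)) \<and>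
       (\<forall>\<^sub>F n in sequentially. Sigma_tot \<nu> (\<Lambda> n) (M n) (P n) \<le> 0.25 \<and>
          256 * (S_sup \<nu> (\<Lambda> n) (M n))\<^sup>2 * real (M n) * real n \<le> 1)"
    and exp_moments: "\<And>i. i \<in> {1, 2} \<Longrightarrow>
      (\<lambda>n. ennreal (1 / (alpha_ratio \<phi>G \<phi>F c n)\<^sup>2) *
         (\<Prod>m=1..M n. exp_moment (P n) i n (S_int \<nu> (f0 n) (\<Lambda> n) m))) \<longlonglongrightarrow> 0"
  shows "liminf (\<lambda>n. INF T\<in>estimators \<nu> n.
           ennreal (\<phi>F n powr (- 2 * c)) * (risk \<nu> \<Phi> n T F)\<^sup>2 +
           ennreal (1 / (\<psi> n)\<^sup>2) * (risk \<nu> \<Phi> n T G)\<^sup>2)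
         \<ge> ennreal (107 / (144 * exp 1))"
proof (rule Liminf_bounded)
  \<comment> \<open>In the first alternative \<open>rho\<close> is identically 0; in the second all
    coordinates and all integrals of the \<open>\<Lambda> n m\<close> are nonnegative.\<close>
  have nonneg_rho: "0 \<le> rho \<nu> (\<Lambda> n) (M n) y * rho \<nu> (\<Lambda> n) (M n) z"
    if n: "1 \<le> n" and y: "y \<in> cube (Y n) (M n)" and z: "z \<in> cube (Y n) (M n)" for n y z
    using alternatives
  proof (elim disjE conjE)
    assume "\<forall>n\<ge>1. (\<forall>m\<in>{1..M n}. lam \<nu> (\<Lambda> n) m = 0) \<and>
          Y_plus \<nu> (f0 n) (\<Lambda> n) (M n) (Y n) = cube (Y n) (M n)"
    then show ?thesis using n by (simp add: rho_def)
  next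
    assume *: "\<forall>n\<ge>1. cube (Y n) (M n) \<subseteq> cube {0..1} (M n) \<and>
          (\<forall>m\<in>{1..M n}. \<forall>x\<in>space \<nu>. 0 \<le> \<Lambda> n m x)"
    have "0 \<le> rho \<nu> (\<Lambda> n) (M n) w" if "w \<in> cube (Y n) (M n)" for w
      unfolding rho_def lam_def using n * that
      by (intro sum_nonneg mult_nonneg_nonneg integral_nonneg_AE AE_I2)
         (auto simp: cube_def PiE_def Pi_def subset_iff)
    then show ?thesis using y z by simp
  qed
  have "(\<lambda>n. ennreal (1 / (alpha_ratio \<phi>G \<phi>F c n)\<^sup>2) *
         (\<Prod>m=1..M n. exp_moment (P n) 1 n (S_int \<nu> (f0 n) (\<Lambda> n) m))) \<longlonglongrightarrow> 0"
    using exp_moments[of 1] by simp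
  \<comment> \<open>Any threshold up to 229/231 - 107/(144 e) would serve; 1/4 lies well below
    it.\<close>
  then have "\<forall>\<^sub>F n in sequentially. ennreal (1 / (alpha_ratio \<phi>G \<phi>F c n)\<^sup>2) *
         (\<Prod>m=1..M n. exp_moment (P n) 1 n (S_int \<nu> (f0 n) (\<Lambda> n) m)) < ennreal (1 / 4)"
    by (rule order_tendstoD) simp
  moreover have "\<forall>\<^sub>F n in sequentially. 0 < alpha_ratio \<phi>G \<phi>F c n"
    using alpha by (simp add: filterlim_at_top_dense)
  moreover have "\<forall>\<^sub>F n in sequentially. 1 \<le> \<psi> n / \<phi>G n"
    using \<psi>(2) by (simp add: filterlim_at_top)
  moreover have "\<forall>\<^sub>F n in sequentially. 0 < \<phi>F n" "\<forall>\<^sub>F n in sequentially. 0 < \<phi>G n"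
    using rates by (auto simp: minimax_rate_def)
  moreover note separated eventually_ge_at_top[of "1::nat"]
  ultimately show "\<forall>\<^sub>F n in sequentially. ennreal (107 / (144 * exp 1)) \<le>
      (INF T\<in>estimators \<nu> n. ennreal (\<phi>F n powr (- 2 * c)) * (risk \<nu> \<Phi> n T F)\<^sup>2 +
         ennreal (1 / (\<psi> n)\<^sup>2) * (risk \<nu> \<Phi> n T G)\<^sup>2)"
  proof eventually_elim
    fix n
    let ?a = "alpha_ratio \<phi>G \<phi>F c n"
    let ?K = "\<Prod>m=1..M n. exp_moment (P n) 1 n (S_int \<nu> (f0 n) (\<Lambda> n) m)"
    assume K: "ennreal (1 / ?a\<^sup>2) * ?K < ennreal (1 / 4)" and a: "0 < ?a"
      and \<psi>G: "1 \<le> \<psi> n / \<phi>G n" and F0: "0 < \<phi>F n" and G0: "0 < \<phi>G n"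
      and sep: "measure (prod_prob (P n) (M n)) (Y_func \<nu> \<Phi> (f0 n) (\<Lambda> n) (M n) (Y n) (\<psi> n)) \<ge> 230 / 231"
      and n: "1 \<le> n"
    have G\<psi>: "\<phi>G n \<le> \<psi> n" using \<psi>G G0 by (simp add: field_simps)
    then have \<psi>0: "0 < \<psi> n" using G0 by simp
    have \<Phi>0: "\<bar>\<Phi> (f0 n)\<bar> < \<infinity>" using f0(1)[OF n] classes by (auto simp: admissible_densities_def)
    \<comment> \<open>The weight in \<open>K\<close> is positive, so an infinite product would stay
      infinite after weighting.\<close>
    have "?K < \<infinity>"
    proof (rule ccontr)
      assume "\<not> ?K < \<infinity>"
      then have "?K = \<infinity>" by (simp flip: less_top)
      with K a show False by (simp add: ennreal_mult_top)
    qed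
    moreover have "\<not> (AE u in P n. u = 0)"
      using sep \<psi>0 \<Phi>0 P[OF n]
      by (intro separated_imp_nondegenerate[where \<nu> = \<nu> and \<Phi> = \<Phi> and ?f0.0 = "f0 n" and \<Lambda> = "\<Lambda> n"
          and M = "M n" and Y = "Y n" and \<psi> = "\<psi> n"]) auto
    ultimately have S: "S_int \<nu> (f0 n) (\<Lambda> n) m < \<infinity>" if "m \<in> {1..M n}" for m
      using n that by (intro finite_prod_exp_moment_imp_S_finite[OF P[OF n],
            where S = "S_int \<nu> (f0 n) (\<Lambda> n)" and n = n and M = "M n"]) auto
    have support: "x \<in> Q n m" if "m \<in> {1..M n}" "x \<in> space \<nu>" "\<Lambda> n m x \<noteq> 0" for m x
      using supports(2)[OF n that(1)] that by (auto simp: supp_on_def)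
    have vanish: "\<Lambda> n m x = 0" if "m \<in> {1..M n}" "x \<in> space \<nu>" "f0 n x = 0" for m x
      using support[OF that(1,2)] f0(2)[OF n, of x] that by force
    have orth: "\<Lambda> n m x * \<Lambda> n k x = 0"
      if "m \<in> {1..M n}" "k \<in> {1..M n}" "m \<noteq> k" "x \<in> space \<nu>" for m k x
    proof -
      have "Q n m \<inter> Q n k = {}"
        using supports(1)[OF n] that by (simp add: disjoint_family_on_def)
      then show ?thesis using support[of m x] support[of k x] that by fastforce
    qed
    show "ennreal (107 / (144 * exp 1)) \<le>
      (INF T\<in>estimators \<nu> n. ennreal (\<phi>F n powr (- 2 * c)) * (risk \<nu> \<Phi> n T F)\<^sup>2 +
         ennreal (1 / (\<psi> n)\<^sup>2) * (risk \<nu> \<Phi> n T G)\<^sup>2)"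
    proof (rule INF_greatest)
      fix T assume T: "T \<in> estimators \<nu> n"
      let ?X = "ennreal (\<phi>F n powr (- 2 * c)) * (risk \<nu> \<Phi> n T F)\<^sup>2 +
         ennreal (1 / (\<psi> n)\<^sup>2) * (risk \<nu> \<Phi> n T G)\<^sup>2"
      \<comment> \<open>The level \<open>t\<close> is taken to be \<open>?a\<^sup>2\<close>. Because
        \<open>\<phi>G n \<le> \<psi> n\<close>, the resulting weight of the risk over
        \<open>F\<close> is at most the prescribed one.\<close>
      have "?a\<^sup>2 / (\<psi> n)\<^sup>2 = \<phi>F n powr (- 2 * c) * (\<phi>G n / \<psi> n)\<^sup>2"
        using F0 by (simp add: alpha_ratio_def power_divide powr_minus divide_simps power2_eq_square
            flip: powr_add)
      also have "\<dots> \<le> \<phi>F n powr (- 2 * c) * 1"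
        using G\<psi> G0 \<psi>0 by (intro mult_left_mono power_le_one) auto
      finally have coeff: "?a\<^sup>2 / (\<psi> n)\<^sup>2 \<le> \<phi>F n powr (- 2 * c)" by simp
      have "ennreal (229 / 231) \<le> ennreal (?a\<^sup>2 / (\<psi> n)\<^sup>2) * (risk \<nu> \<Phi> n T F)\<^sup>2 +
         ennreal (1 / (\<psi> n)\<^sup>2) * (risk \<nu> \<Phi> n T G)\<^sup>2 + ennreal (1 / ?a\<^sup>2) * ?K"
        using a \<Lambda>[OF n]
        by (intro two_class_risk_bound[where Y = "Y n"] classes f0(1) n P vanish orth S nonneg_rho
            in_class sep \<psi>0 T) auto
      also have "\<dots> \<le> ?X + ennreal (1 / 4)"
        using coeff K by (intro add_mono mult_right_mono ennreal_leI) auto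
      finally have X: "ennreal (229 / 231) \<le> ?X + ennreal (1 / 4)" .
      \<comment> \<open>The crude bound e \<ge> 2 is enough, since 107/288 + 1/4 is still below
        229/231.\<close>
      have "(107 / (144 * exp 1) :: real) \<le> 107 / 288"
        using exp_ge_add_one_self[of 1] by (simp add: field_simps)
      then have const: "107 / (144 * exp 1) + 1 / 4 < (229 / 231 :: real)" by simp
      show "ennreal (107 / (144 * exp 1)) \<le> ?X"
      proof (cases ?X)
        case (real r)
        then have "229 / 231 \<le> r + 1 / 4"
          using X by (simp flip: ennreal_plus)
        then show ?thesis using const real by (simp add: ennreal_leI)
      next
        case top
        show ?thesis unfolding top by simp
      qed
    qed
  qed
qed

end
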